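(* Let $p_1\equiv 7\pmod 8$ be a prime, $m\ge1$, $N=2p_1^m$, and let $p\equiv 3\pmod 4$ be a prime with $f:=\mathrm{ord}_N(p)=\phi(N)/2$. Let $s$ be odd, $q=p^{fs}$, and let $I\subseteq\mathbb{Z}/N\mathbb{Z}$ satisfy $\{i \bmod p_1^m: i\in I\}=\mathbb{Z}/p_1^m\mathbb{Z}$. Let $t$ be an odd prime with $\gcd(t,p_1)=1$, let $\gamma$ be a primitive element of $\mathbb{F}_{q^t}$ and $\omega=\gamma^{(q^t-1)/(q-1)}$ (a primitive element of $\mathbb{F}_q$). Let $D=\bigcup_{i\in I}\omega^i\langle\omega^N\rangle\subseteq\mathbb{F}_q$ and let $D'=\bigcup_{i\in I}\gamma^i\langle\gamma^N\rangle\subseteq\mathbb{F}_{q^t}$ be its lift. Let $t^{-1}$ denote the inverse of $t$ modulo $N$ and $D^{(t^{-1})}=\bigcup_{i\in I}\omega^{t^{-1}i}\langle\omega^N\rangle$. Fix $a\in\mathbb{F}_p^\ast\setminus\{1\}$. If the set $\{T_{\omega^\ell,a}(D^{(t^{-1})}) \bmod t : 0\le\ell\le N-1\}$ contains $u$ distinct elements, then the set $\{T_{\gamma^\ell,a}(D')\bmod t: 0\le \ell\le N-1\}$ also contains $u$ distinct elements.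
   Context: For a subset $E$ of a finite field $\mathbb{F}$ of characteristic $p$, an element $x\in\mathbb{F}^\ast$, and $a\in\mathbb{F}_p^\ast\setminus\{1\}$, the triple intersection number is $T_{x,a}(E)=|E\cap(E-x)\cap(E-ax)|$, where $E-y=\{e-y:e\in E\}$. Here $\langle\omega^N\rangle$ is the multiplicative subgroup generated by $\omega^N$, and $\omega^i\langle\omega^N\rangle$ its coset. (Under these hypotheses $D$ and $D'$ are skew Hadamard difference sets, i.e. difference sets with $G=D\sqcup(-D)\sqcup\{0\}$.) *)

theory Defs
  imports
    "HOL-Computational_Algebra.Primes"
    "HOL-Number_Theory.Number_Theory"
    "HOL-Library.Cardinality"
begin

(* T_{x,a}(E). E may lie in a subfield containing x and a: all three translates then lie in that
   subfield, so the count is the same in the subfield and in the ambient field. *)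
definition triple_intersection :: "'a::comm_ring_1 \<Rightarrow> 'a \<Rightarrow> 'a set \<Rightarrow> nat" where
  "triple_intersection x a E =
     card (E \<inter> (\<lambda>e. e - x) ` E \<inter> (\<lambda>e. e - a * x) ` E)"

definition mult_generate :: "'a::field \<Rightarrow> 'a set" where
  "mult_generate x = range (\<lambda>k::int. x powi k)"

(* The case g = 0 is excluded because 0 powi k = 0 for nonzero k. *)
definition primitive_element :: "'a::field \<Rightarrow> bool" where
  "primitive_element g \<longleftrightarrow> mult_generate g = UNIV - {0}"

(* The coset g^i <g^N>, which depends on i only modulo N. Residues modulo N are therefore
   represented by natural numbers. *)
definition cyclotomic_class :: "nat \<Rightarrow> 'a::field \<Rightarrow> nat \<Rightarrow> 'a set" where
  "cyclotomic_class N g i = (\<lambda>y. g ^ i * y) ` mult_generate (g ^ N)"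

(* The integer multiples of 1; this is the prime subfield because the characteristic is positive. *)
definition prime_subfield :: "'a::finite_field set" where
  "prime_subfield = range of_int"

end

theory Submission
  imports Defs
begin

text \<open>
  The map \<open>y \<mapsto> y ^ q\<close> is an automorphism whose order divides the prime \<open>t\<close>. It preserves \<open>D'\<close>,
  because \<open>q\<close> is congruent to 1 modulo \<open>N\<close>, and it fixes \<open>a\<close>. Hence for \<open>x\<close> in the subfield with \<open>q\<close>
  elements it permutes the points counted by \<open>triple_intersection x a D'\<close>, and modulo \<open>t\<close> only those in
  the subfield matter. Since \<open>(q ^ t - 1) div (q - 1) = 1 + q + \<dots> + q ^ (t - 1)\<close> is congruent to \<open>t\<close>
  modulo \<open>N\<close>, the intersection of \<open>D'\<close> with the subfield is \<open>Dinv\<close>, and \<open>\<omega> ^ l\<close> lies in the class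
  of \<open>\<gamma> ^ (t * l)\<close>. So the count for \<open>\<omega> ^ l\<close> and \<open>Dinv\<close> agrees modulo \<open>t\<close> with the one for
  \<open>\<gamma> ^ (t * l)\<close> and \<open>D'\<close>, and \<open>l \<mapsto> t * l\<close> permutes the residues modulo \<open>N\<close>.
\<close>

section \<open>Counting fixed points modulo a prime\<close>

text \<open>The iterates of \<open>f\<close> give an action of the cyclic group of order
  \<open>t\<close> on \<open>S\<close>. Since \<open>t\<close> is prime, a point that
  \<open>f\<close> moves has an orbit of exactly \<open>t\<close> elements, so the moved points
  contribute a multiple of \<open>t\<close>.\<close>

lemma card_cong_card_fixed_points:
  fixes f :: "'a \<Rightarrow> 'a"
  assumes t: "prime t" and S: "finite S" "f ` S \<subseteq> S"
    and ft: "\<And>x. x \<in> S \<Longrightarrow> (f ^^ t) x = x"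
  shows "[card S = card {x \<in> S. f x = x}] (mod t)"
proof -
  define M where "M = {x \<in> S. f x \<noteq> x}"
  define orb where "orb x = range (\<lambda>i. (f ^^ i) x)" for x
  have t0: "t > 0" using t by (simp add: prime_gt_0_nat)
  have red: "(f ^^ i) x = (f ^^ j) x" if "x \<in> S" "[i = j] (mod t)" for x i j
    using that ft[of x] unfolding cong_def by (metis funpow_mod_eq)
  have fS: "(f ^^ i) x \<in> S" if "x \<in> S" for x i
    using that S(2) by (induction i) auto
  \<comment> \<open>No inverse of \<open>f\<close> is at hand; \<open>t - i mod t\<close> further
    iterations bring the total to a multiple of \<open>t\<close> and so undo the first
    \<open>i\<close>.\<close>
  have undo: "(f ^^ (k + (t - i mod t))) ((f ^^ i) x) = (f ^^ k) x" if "x \<in> S" for x k i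
  proof -
    have "[k + (t - i mod t) + i = k] (mod t)"
    proof -
      have "k + (t - i mod t) + i = k + t * (1 + i div t)"
        using mod_less_divisor[OF t0, of i] mult_div_mod_eq[of t i]
        by (simp only: distrib_left mult_1_right)
      then show ?thesis by (simp only: cong_def mod_mult_self2)
    qed
    then show ?thesis using red[OF that] by (metis funpow_add o_apply)
  qed
  have orbM: "orb x \<subseteq> M" if "x \<in> M" for x
  proof -
    \<comment> \<open>A fixed iterate \<open>(f ^^ i) x\<close> would, by \<open>undo\<close>, equal
      every iterate of \<open>x\<close>, in particular both \<open>x\<close> and
      \<open>f x\<close>.\<close>
    have "f ((f ^^ i) x) \<noteq> (f ^^ i) x" for i
    proof
      assume "f ((f ^^ i) x) = (f ^^ i) x"
      then have "(f ^^ Suc 0) ((f ^^ i) x) = (f ^^ i) x" by simp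
      then have fix1: "(f ^^ k) ((f ^^ i) x) = (f ^^ i) x" for k
        by (induction k) auto
      have "x \<in> S" using that by (simp add: M_def)
      then have "(f ^^ k) x = (f ^^ i) x" for k
        using trans[OF undo[symmetric] fix1] by blast
      from trans[OF this[of 0] this[of 1, symmetric]] have "f x = x" by simp
      then show False using that by (simp add: M_def)
    qed
    then show ?thesis using fS that unfolding orb_def M_def by auto
  qed
  have un: "\<Union> (orb ` M) = M"
  proof
    show "\<Union> (orb ` M) \<subseteq> M" using orbM by blast
    have "x \<in> orb x" for x
      unfolding orb_def by (rule range_eqI[of _ _ 0]) simp
    then show "M \<subseteq> \<Union> (orb ` M)" by blast
  qed
  have inj: "inj_on (\<lambda>i. (f ^^ i) x) {..<t}" if x: "x \<in> M" for x
  proof (rule linorder_inj_onI)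
    fix i j assume ij: "i < j" "i \<in> {..<t}" "j \<in> {..<t}"
    have xS: "x \<in> S" and fx: "f x \<noteq> x" using x by (auto simp: M_def)
    show "(f ^^ i) x \<noteq> (f ^^ j) x"
    proof
      assume eq: "(f ^^ i) x = (f ^^ j) x"
      have "(f ^^ (t - i)) ((f ^^ j) x) = (f ^^ (t - i + j)) x" by (simp add: funpow_add)
      also have "\<dots> = (f ^^ (j - i)) x"
      proof (rule red[OF xS])
        have "t - i + j = (j - i) + t" using ij by simp
        then show "[t - i + j = j - i] (mod t)" by (simp add: cong_def)
      qed
      finally have d: "(f ^^ (j - i)) x = x"
        using undo[OF xS, of 0 i] ij eq by simp
      \<comment> \<open>Since \<open>0 < j - i < t\<close> and \<open>t\<close> is prime, some
        multiple of the period \<open>j - i\<close> is 1 modulo \<open>t\<close>, which forces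
        \<open>f x = x\<close>.\<close>
      have "coprime (j - i) t"
        using ij t by (metis coprime_commute less_imp_diff_less lessThan_iff nat_dvd_not_less
            prime_imp_coprime zero_less_diff)
      then obtain k where "[(j - i) * k = 1] (mod t)"
        using cong_solve_coprime_nat by auto
      then have "(f ^^ ((j - i) * k)) x = f x"
        using red[OF xS, of "(j - i) * k" 1]
        by (simp only: funpow.simps o_apply id_apply One_nat_def)
      moreover have "(f ^^ ((j - i) * k)) x = x"
        using funpow_mod_eq[OF d, of "(j - i) * k"]
        by (simp only: mod_mult_self1_is_0 funpow_0)
      ultimately show False using fx by simp
    qed
  qed auto
  have card_orb: "card (orb x) = t" if x: "x \<in> M" for x
  proof -
    have xS: "x \<in> S" using x by (simp add: M_def)
    have "(f ^^ i) x \<in> (\<lambda>i. (f ^^ i) x) ` {..<t}" for i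
    proof
      show "(f ^^ i) x = (f ^^ (i mod t)) x" by (rule red[OF xS]) (simp add: cong_def)
    qed (use t0 in simp)
    then have "orb x = (\<lambda>i. (f ^^ i) x) ` {..<t}" unfolding orb_def by blast
    then show ?thesis using inj[OF x] by (simp add: card_image)
  qed
  have sub: "orb x \<subseteq> orb y" if "x \<in> S" "y \<in> S" "(f ^^ i) x = (f ^^ j) y" for x y i j
  proof
    fix z assume "z \<in> orb x"
    then obtain k where "z = (f ^^ k) x" by (auto simp: orb_def)
    then have "z = (f ^^ (k + (t - i mod t) + j)) y"
      using undo[OF that(1), of k i] that(3) by (simp add: funpow_add)
    then show "z \<in> orb y" by (simp add: orb_def)
  qed
  have disj: "orb x \<inter> orb y = {}" if "x \<in> M" "y \<in> M" "orb x \<noteq> orb y" for x y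
  proof (rule ccontr)
    assume "orb x \<inter> orb y \<noteq> {}"
    then obtain i j where "(f ^^ i) x = (f ^^ j) y" unfolding orb_def by auto
    then show False using sub[of x y i j] sub[of y x j i] that by (auto simp: M_def)
  qed
  have "t dvd card (\<Union> (orb ` M))"
  proof (rule dvd_partition)
    show "finite (\<Union> (orb ` M))" using S(1) un by (simp add: M_def)
  qed (use card_orb disj in auto)
  then have "t dvd card M" using un by simp
  moreover have "card S = card {x \<in> S. f x = x} + card M"
  proof -
    have "S = {x \<in> S. f x = x} \<union> M" by (auto simp: M_def)
    then show ?thesis using S(1) card_Un_disjoint[of "{x \<in> S. f x = x}" M]
      by (auto simp: M_def)
  qed
  ultimately show ?thesis by (simp add: cong_add_lcancel_0_nat cong_0_iff)
qed

section \<open>Triple intersection numbers\<close>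

lemma triple_intersection_eq:
  "triple_intersection x a E = card {e \<in> E. e + x \<in> E \<and> e + a * x \<in> E}"
proof -
  have "(e \<in> (\<lambda>e. e - y) ` E) \<longleftrightarrow> e + y \<in> E" for e y :: 'a
    by (auto intro!: image_eqI[of _ _ "e + y"])
  then show ?thesis
    unfolding triple_intersection_def by (intro arg_cong[of _ _ card]) auto
qed

text \<open>The bijection is \<open>e \<mapsto> c * e\<close>. With \<open>c\<close> a power of
  \<open>\<gamma> ^ N\<close>, this makes the count at \<open>\<gamma> ^ l\<close> depend only on
  \<open>l\<close> modulo \<open>N\<close>.\<close>

lemma triple_intersection_scale:
  fixes c :: "'a::field"
  assumes c: "c \<noteq> 0" and inv: "\<And>y. c * y \<in> E \<longleftrightarrow> y \<in> E"
  shows "triple_intersection (c * x) a E = triple_intersection x a E"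
  unfolding triple_intersection_eq
proof (rule bij_betw_same_card[symmetric], rule bij_betwI)
  have shift: "c * e + a * (c * x) = c * (e + a * x)" "c * e + c * x = c * (e + x)" for e
    by (simp_all add: algebra_simps)
  show "(*) c \<in> {e \<in> E. e + x \<in> E \<and> e + a * x \<in> E} \<rightarrow>
      {e \<in> E. e + c * x \<in> E \<and> e + a * (c * x) \<in> E}"
    using inv by (auto simp: shift)
  have "inverse c * e \<in> E" "inverse c * e + x \<in> E" "inverse c * e + a * x \<in> E"
    if "e \<in> E" "e + c * x \<in> E" "e + a * (c * x) \<in> E" for e
  proof -
    have "c * (inverse c * e) = e" "c * (inverse c * e + x) = e + c * x"
      "c * (inverse c * e + a * x) = e + a * (c * x)"
      using c by (simp_all add: field_simps)
    then show "inverse c * e \<in> E" "inverse c * e + x \<in> E" "inverse c * e + a * x \<in> E"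
      using that inv by metis+
  qed
  then show "(*) (inverse c) \<in> {e \<in> E. e + c * x \<in> E \<and> e + a * (c * x) \<in> E} \<rightarrow>
      {e \<in> E. e + x \<in> E \<and> e + a * x \<in> E}" by auto
qed (use c in auto)

section \<open>Primitive elements and cyclotomic classes\<close>

lemma primitive_element_nonzero:
  assumes "primitive_element (g :: 'a::field)" "CARD('a) > 2"
  shows "g \<noteq> 0"
proof
  assume "g = 0"
  then have "UNIV - {0} \<subseteq> {0, 1 :: 'a}"
    using assms(1) unfolding primitive_element_def mult_generate_def
    by (auto simp: power_int_0_left_if split: if_splits)
  then have "(UNIV :: 'a set) \<subseteq> {0, 1}" by auto
  then have "CARD('a) \<le> card {0, 1 :: 'a}" by (intro card_mono) auto
  then show False using assms(2) by simp
qed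

text \<open>The exponent \<open>CARD('a) - 1\<close> gives 1 because the \<open>CARD('a)\<close>-th
  power map is the identity. A smaller positive period \<open>d\<close> would yield at most
  \<open>d\<close> powers, too few to cover the nonzero elements.\<close>

lemma primitive_element_powi_eq_1_iff:
  fixes g :: "'a::finite_field"
  assumes g: "primitive_element g" "g \<noteq> 0"
  shows "g powi k = 1 \<longleftrightarrow> int (CARD('a) - 1) dvd k"
proof -
  define n where "n = CARD('a) - 1"
  have "CARD('a) > 1"
    using finite_UNIV_card_ge_0 card_mono[of UNIV "{0, 1 :: 'a}"] by simp
  then have n0: "n > 0" by (simp add: n_def)
  have gn: "g ^ n = 1"
  proof -
    have "g * g ^ n = g * 1"
      using finite_field_power_card_eq_same[of g] \<open>CARD('a) > 1\<close>
      by (simp add: n_def flip: power_Suc)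
    then show ?thesis using g(2) by simp
  qed
  \<comment> \<open>Stated for any period \<open>d\<close>: \<open>min\<close> needs it for a
    hypothetical smaller one, the conclusion for \<open>n\<close>.\<close>
  have red: "g powi k = g ^ nat (k mod int d)" if "g ^ d = 1" "d > 0" for d k
  proof -
    have "g powi k = g powi (int d * (k div int d) + k mod int d)" by simp
    also have "\<dots> = (g ^ d) powi (k div int d) * g powi (k mod int d)"
      by (subst power_int_add) (simp_all add: g(2) power_int_power)
    also have "\<dots> = g ^ nat (k mod int d)"
      using that by (simp add: power_int_nonneg_exp)
    finally show ?thesis .
  qed
  have min: "n \<le> d" if "g ^ d = 1" "d > 0" for d
  proof -
    have "UNIV - {0} \<subseteq> (\<lambda>i. g ^ i) ` {..<d}"
    proof
      fix y :: 'a assume "y \<in> UNIV - {0}"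
      then obtain k where "y = g powi k"
        using g(1) unfolding primitive_element_def mult_generate_def by auto
      then have "y = g ^ nat (k mod int d)" using red[OF that] by simp
      moreover have "nat (k mod int d) < d" using that(2) by (simp add: nat_less_iff)
      ultimately show "y \<in> (\<lambda>i. g ^ i) ` {..<d}" by auto
    qed
    then have "card (UNIV - {0 :: 'a}) \<le> card ((\<lambda>i. g ^ i) ` {..<d})"
      by (intro card_mono) auto
    also have "\<dots> \<le> d" using card_image_le[of "{..<d}"] by simp
    finally show ?thesis by (simp add: n_def card_Diff_singleton)
  qed
  have "g powi k = 1 \<longleftrightarrow> k mod int n = 0"
  proof
    assume "g powi k = 1"
    then have "g ^ nat (k mod int n) = 1" using red[OF gn n0] by simp
    moreover have "nat (k mod int n) < n" using n0 by (simp add: nat_less_iff)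
    ultimately have "nat (k mod int n) = 0" using min by fastforce
    then show "k mod int n = 0" using n0 pos_mod_sign[of "int n" k] by linarith
  qed (simp add: red[OF gn n0])
  then show ?thesis by (auto simp: n_def)
qed

text \<open>Hypothesis \<open>N\<close> makes exponents of \<open>g\<close> well defined modulo
  \<open>N\<close>. Unlike primitivity in \<open>'a\<close>, it also holds for
  \<open>\<omega>\<close>, which generates only the units of a subfield.\<close>

lemma powi_in_cyclotomic_class_iff:
  fixes g :: "'a::field"
  assumes g: "g \<noteq> 0" and N: "\<And>k. g powi k = 1 \<Longrightarrow> int N dvd k"
  shows "g powi j \<in> cyclotomic_class N g i \<longleftrightarrow> [j = int i] (mod int N)"
proof
  assume "g powi j \<in> cyclotomic_class N g i"
  then obtain k where "g powi j = g ^ i * (g ^ N) powi k"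
    unfolding cyclotomic_class_def mult_generate_def by auto
  also have "\<dots> = g powi (int i + int N * k)"
    using g by (simp add: power_int_add power_int_power)
  finally have "g powi (j - (int i + int N * k)) = 1" using g by (simp add: power_int_diff)
  then have "int N dvd (j - int i) - int N * k" using N by (simp add: algebra_simps)
  then have "int N dvd j - int i"
    using dvd_add[OF _ dvd_triv_left[of "int N" k]] by fastforce
  then show "[j = int i] (mod int N)" by (simp add: cong_iff_dvd_diff)
next
  assume "[j = int i] (mod int N)"
  then obtain k where "j = int i + int N * k"
    by (metis cong_iff_lin cong_sym)
  then have "g powi j = g ^ i * (g ^ N) powi k"
    using g by (simp add: power_int_add power_int_power)
  then show "g powi j \<in> cyclotomic_class N g i"
    unfolding cyclotomic_class_def mult_generate_def by auto
qed

lemma zero_notin_cyclotomic_class: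
  assumes "g \<noteq> 0" shows "0 \<notin> cyclotomic_class N g i"
  using assms by (auto simp: cyclotomic_class_def mult_generate_def)

section \<open>Frobenius on the prime subfield, and permuted residues\<close>

text \<open>The map is additive and fixes 1; the induction runs in both directions from 0. This
  supplies \<open>a ^ q = a\<close>.\<close>

lemma of_int_power_CHAR_power:
  fixes k :: int
  assumes "prime CHAR('a::field)"
  shows "(of_int k :: 'a) ^ (CHAR('a) ^ n) = of_int k"
proof (induction k rule: int_induct[where k = 0])
  case base
  then show ?case using assms by (simp add: power_0_left prime_gt_0_nat)
next
  case (step1 i)
  then show ?case using assms by (simp add: freshmans_dream')
next
  case (step2 i)
  have "(of_int (i - 1) + 1 :: 'a) ^ (CHAR('a) ^ n) = of_int (i - 1) ^ (CHAR('a) ^ n) + 1"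
    using assms by (subst freshmans_dream') auto
  then show ?case using step2 by (simp add: eq_diff_eq)
qed

text \<open>Multiplication by \<open>c\<close>, with inverse \<open>d\<close>, permutes the residues
  modulo \<open>N\<close>, and \<open>F\<close> sees only residues.\<close>

lemma image_eq_of_mult_mod:
  fixes F G :: "nat \<Rightarrow> 'b"
  assumes N: "N > 0" and G: "\<And>l. G l = F (c * l)"
    and F: "\<And>l l'. [l = l'] (mod N) \<Longrightarrow> F l = F l'" and c: "[c * d = 1] (mod N)"
  shows "F ` {0..N - 1} = G ` {0..N - 1}"
proof -
  have modI: "l mod N \<in> {0..N - 1}" for l
    using mod_less_divisor[OF N, of l] by simp
  show ?thesis
  proof (intro equalityI image_subsetI)
    fix l
    have "[c * (d * l mod N) = l] (mod N)"
    proof -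
      have "[c * (d * l mod N) = c * d * l] (mod N)"
        by (simp add: cong_def mod_mult_right_eq mult.assoc)
      also have "[c * d * l = 1 * l] (mod N)" using c by (rule cong_scalar_right)
      finally show ?thesis by simp
    qed
    then have "F l = G (d * l mod N)" using F G by metis
    then show "F l \<in> G ` {0..N - 1}" using modI by auto
    have "G l = F (c * l mod N)" unfolding G by (rule F) (simp add: cong_def)
    then show "G l \<in> F ` {0..N - 1}" using modI by auto
  qed
qed

theorem theorem3p1:
  fixes p1 m N p f s q t tinv u :: nat
    and I :: "nat set"
    and \<gamma> \<omega> a :: "'a::finite_field"
    and D D' Dinv :: "'a set"
  assumes p1: "prime p1" "[p1 = 7] (mod 8)"
    and m: "m \<ge> 1"
    and N: "N = 2 * p1 ^ m"
    and p: "prime p" "[p = 3] (mod 4)"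
    and f: "f = ord N p" "2 * f = totient N"
    and s: "odd s"
    and q: "q = p ^ (f * s)"
    and I: "I \<subseteq> {0..<N}" "(\<lambda>i. i mod p1 ^ m) ` I = {0..<p1 ^ m}"
    and t: "prime t" "odd t" "gcd t p1 = 1"
    and card_field: "CARD('a) = q ^ t"
    and \<gamma>: "primitive_element \<gamma>"
    and \<omega>: "\<omega> = \<gamma> ^ ((q ^ t - 1) div (q - 1))"
    and D: "D = (\<Union>i\<in>I. cyclotomic_class N \<omega> i)"
    and D': "D' = (\<Union>i\<in>I. cyclotomic_class N \<gamma> i)"
    and tinv: "[t * tinv = 1] (mod N)"
    and Dinv: "Dinv = (\<Union>i\<in>I. cyclotomic_class N \<omega> (tinv * i))"
    and a: "a \<in> prime_subfield" "a \<noteq> 0" "a \<noteq> 1"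
    and u: "card {triple_intersection (\<omega> ^ l) a Dinv mod t | l. l \<in> {0..N - 1}} = u"
  shows "card {triple_intersection (\<gamma> ^ l) a D' mod t | l. l \<in> {0..N - 1}} = u"
proof -

  \<comment> \<open>Arithmetic of the exponents modulo \<open>N\<close>\<close>
  define r where "r = (q ^ t - 1) div (q - 1)"
  \<comment> \<open>\<open>P j\<close> will express that \<open>\<gamma> powi j\<close> lies in
    \<open>D'\<close>, so that membership becomes a condition on exponents.\<close>
  define P where "P j \<longleftrightarrow> (\<exists>i\<in>I. [j = int i] (mod int N))" for j
  have N0: "N > 0" using N p1(1) by (simp add: prime_gt_0_nat)
  then have f0: "f > 0" using f(2) totient_gt_0_iff[of N] by (cases "f = 0") auto
  have t0: "t > 0" using t(1) by (simp add: prime_gt_0_nat)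
  have p3: "p \<ge> 3"
    using p by (cases "p = 2") (auto simp: cong_def dest: prime_ge_2_nat)
  have "p ^ 1 \<le> p ^ (f * s)"
    using p3 f0 s by (intro power_increasing) (auto simp: Suc_le_eq odd_pos)
  then have q3: "q \<ge> 3" using p3 q by simp
  have "q ^ 1 \<le> q ^ t" using q3 t0 by (intro power_increasing) auto
  then have qt3: "q ^ t \<ge> 3" using q3 by simp
  have q1: "[q = 1] (mod N)"
    unfolding q power_mult f(1) using cong_pow[OF conjunct1[OF ord_works[of p N]], of s] by simp
  \<comment> \<open>Integers avoid truncated subtraction in the geometric series. Each summand
    \<open>q ^ i\<close> is 1 modulo \<open>N\<close>, whence \<open>rt\<close>.\<close>
  have sum_r: "int (q ^ t - 1) = int (q - 1) * (\<Sum>i<t. int q ^ i)"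
    using power_diff_1_eq[of "int q" t] q3 qt3 by (simp add: of_nat_diff)
  have r_sum: "int r = (\<Sum>i<t. int q ^ i)"
    using q3 unfolding r_def of_nat_div sum_r by simp
  have qr: "int (q ^ t - 1) = int (q - 1) * int r" using sum_r r_sum by simp
  have "[(\<Sum>i<t. int q ^ i) = (\<Sum>i<t. 1 ^ i)] (mod int N)"
    using q1 by (intro cong_sum cong_pow) (metis cong_int_iff of_nat_1)
  then have rt: "[int r = int t] (mod int N)" using r_sum by simp
  have Nq1: "int N dvd int (q - 1)"
    using q1 q3 cong_altdef_nat[of 1 q N] by (simp only: int_dvd_int_iff)

  \<comment> \<open>Membership in \<open>D'\<close> and \<open>Dinv\<close> through
    exponents\<close>
  have \<gamma>0: "\<gamma> \<noteq> 0"
    using primitive_element_nonzero[OF \<gamma>] card_field qt3 by simp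
  then have \<omega>0: "\<omega> \<noteq> 0" by (simp add: \<omega>)
  have \<omega>_powi: "\<omega> powi k = \<gamma> powi (int r * k)" for k
    by (simp add: \<omega> r_def power_int_power)
  have \<gamma>1: "\<gamma> powi k = 1 \<longleftrightarrow> int (q - 1) * int r dvd k" for k
    using primitive_element_powi_eq_1_iff[OF \<gamma> \<gamma>0] card_field qr by simp
  have "q ^ t - 1 = (q - 1) * r" using qr by (metis of_nat_eq_iff of_nat_mult)
  then have r0: "r > 0" using qt3 by (cases "r = 0") auto
  have \<gamma>N: "int N dvd k" if "\<gamma> powi k = 1" for k
    using that Nq1 \<gamma>1 by (meson dvd_mult_left dvd_trans)
  \<comment> \<open>In exponents of \<open>\<gamma>\<close> the premise says that
    \<open>(q - 1) * r\<close> divides \<open>r * k\<close>; cancelling \<open>r\<close> leaves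
    \<open>q - 1\<close>, a multiple of \<open>N\<close>.\<close>
  have \<omega>N: "int N dvd k" if "\<omega> powi k = 1" for k
  proof -
    have "int r * int (q - 1) dvd int r * k"
      using that unfolding \<omega>_powi \<gamma>1 by (simp only: mult.commute)
    then have "int (q - 1) dvd k" using r0 by (simp only: dvd_mult_cancel_left) simp
    then show ?thesis using Nq1 dvd_trans by blast
  qed
  have \<gamma>_ex: "\<exists>j. y = \<gamma> powi j" if "y \<noteq> 0" for y
    using \<gamma> that unfolding primitive_element_def mult_generate_def by blast
  have D'_iff: "\<gamma> powi j \<in> D' \<longleftrightarrow> P j" for j
    unfolding D' P_def using powi_in_cyclotomic_class_iff[OF \<gamma>0 \<gamma>N] by auto
  have P_cong: "P j \<longleftrightarrow> P k" if "[j = k] (mod int N)" for j k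
    unfolding P_def using that by (meson cong_sym cong_trans)
  have zD': "0 \<notin> D'" unfolding D' using zero_notin_cyclotomic_class[OF \<gamma>0] by auto
  have zDinv: "0 \<notin> Dinv" unfolding Dinv using zero_notin_cyclotomic_class[OF \<omega>0] by auto
  have tinv_int: "[int t * int tinv = 1] (mod int N)"
    using tinv by (metis cong_int_iff of_nat_1 of_nat_mult)
  \<comment> \<open>Membership in \<open>Dinv\<close> amounts to \<open>P (t * j)\<close> and
    membership in \<open>D'\<close> to \<open>P (r * j)\<close>; \<open>r\<close> and
    \<open>t\<close> agree modulo \<open>N\<close>.\<close>
  have Dinv_iff: "\<omega> powi j \<in> Dinv \<longleftrightarrow> \<omega> powi j \<in> D'" for j
  proof -
    have "[j = int (tinv * i)] (mod int N) \<longleftrightarrow> [int t * j = int i] (mod int N)" for i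
    proof
      assume "[j = int (tinv * i)] (mod int N)"
      then have "[int t * j = int t * int (tinv * i)] (mod int N)" by (rule cong_scalar_left)
      also have "[int t * int (tinv * i) = 1 * int i] (mod int N)"
        using cong_scalar_right[OF tinv_int, of "int i"] by (simp add: mult.assoc)
      finally show "[int t * j = int i] (mod int N)" by simp
    next
      assume "[int t * j = int i] (mod int N)"
      then have "[int tinv * (int t * j) = int tinv * int i] (mod int N)" by (rule cong_scalar_left)
      moreover have "[int t * int tinv * j = 1 * j] (mod int N)"
        using tinv_int by (rule cong_scalar_right)
      ultimately show "[j = int (tinv * i)] (mod int N)"
        by (simp add: algebra_simps) (metis cong_sym cong_trans)
    qed
    then have "\<omega> powi j \<in> Dinv \<longleftrightarrow> P (int t * j)"
      unfolding Dinv P_def using powi_in_cyclotomic_class_iff[OF \<omega>0 \<omega>N] by auto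
    also have "\<dots> \<longleftrightarrow> P (int r * j)"
      by (rule P_cong) (use rt cong_sym cong_scalar_right in blast)
    finally show ?thesis by (simp add: \<omega>_powi D'_iff)
  qed
  \<comment> \<open>For \<open>y = \<gamma> powi j\<close>, both sides say that \<open>r\<close>
    divides \<open>j\<close>.\<close>
  have \<omega>_fixed: "y ^ q = y \<longleftrightarrow> (\<exists>k. y = \<omega> powi k)" if y0: "y \<noteq> 0" for y
  proof -
    obtain j where j: "y = \<gamma> powi j" using \<gamma>_ex[OF y0] by blast
    have "y ^ q = y * y ^ (q - 1)" using q3 by (simp flip: power_Suc)
    then have "y ^ q = y \<longleftrightarrow> y ^ (q - 1) = 1" using y0 by simp
    also have "\<dots> \<longleftrightarrow> int (q - 1) * int r dvd int (q - 1) * j"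
      by (simp add: j power_int_power' \<gamma>1 mult.commute)
    also have "\<dots> \<longleftrightarrow> int r dvd j" using q3 by simp
    finally have eq: "y ^ q = y \<longleftrightarrow> int r dvd j" .
    show ?thesis
    proof
      assume "y ^ q = y"
      then show "\<exists>k. y = \<omega> powi k" using eq by (auto simp: j \<omega>_powi)
    next
      assume "\<exists>k. y = \<omega> powi k"
      then obtain k where "\<gamma> powi j = \<gamma> powi (int r * k)" by (auto simp: j \<omega>_powi)
      then have "\<gamma> powi (j - int r * k) = 1" using \<gamma>0 by (simp add: power_int_diff)
      then have "int r dvd j - int r * k" unfolding \<gamma>1 by (rule dvd_mult_right)
      then show "y ^ q = y" unfolding eq using dvd_add[OF _ dvd_triv_left[of "int r" k]] by fastforce
    qed
  qed
  have Dinv_fixed: "Dinv = {y \<in> D'. y ^ q = y}"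
  proof -
    have ex: "\<exists>k. y = \<omega> powi k" if y: "y \<in> Dinv" for y
    proof -
      obtain i k where "y = \<omega> ^ i * (\<omega> ^ N) powi k"
        using y unfolding Dinv cyclotomic_class_def mult_generate_def by auto
      then have "y = \<omega> powi (int i + int N * k)"
        using \<omega>0 by (simp add: power_int_add power_int_power)
      then show ?thesis by blast
    qed
    have "y \<in> Dinv \<longleftrightarrow> y \<in> D' \<and> y ^ q = y" for y
    \<comment> \<open>Zero satisfies \<open>y ^ q = y\<close> without being a power of
      \<open>\<omega>\<close>, so it is treated apart.\<close>
    proof (cases "y = 0")
      case False
      then show ?thesis using ex Dinv_iff \<omega>_fixed by blast
    qed (simp add: zD' zDinv)
    then show ?thesis by blast
  qed

  \<comment> \<open>Frobenius and scaling symmetries of \<open>D'\<close>\<close>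
  have "CHAR('a) dvd p ^ (f * s * t)"
    using CHAR_dvd_CARD[where 'a = 'a] card_field by (simp add: q power_mult)
  then have char: "CHAR('a) = p"
    using p(1) CHAR_prime[where 'a = 'a] by (metis prime_dvd_power primes_dvd_imp_eq)
  have frob_add: "(x + y) ^ q = x ^ q + y ^ q" for x y :: 'a
    by (rule freshmans_dream'[of _ "f * s"]) (use char q in auto)
  have aq: "a ^ q = a"
    using a(1) of_int_power_CHAR_power[where 'a = 'a, of _ "f * s"] p(1)
    by (auto simp: prime_subfield_def char q)
  \<comment> \<open>The exponent gets multiplied by \<open>q\<close>, which is 1 modulo
    \<open>N\<close>.\<close>
  have frob_D': "y ^ q \<in> D'" if y: "y \<in> D'" for y
  proof -
    obtain j where j: "y = \<gamma> powi j" using \<gamma>_ex y zD' by metis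
    have "[j * int q = j * 1] (mod int N)"
      using q1 by (intro cong_scalar_left) (metis cong_int_iff of_nat_1)
    then show ?thesis using y P_cong by (simp add: j D'_iff power_int_power')
  qed
  have scale_D': "\<gamma> powi (int N * k) * y \<in> D' \<longleftrightarrow> y \<in> D'" for y k
  proof (cases "y = 0")
    case False
    then obtain j where j: "y = \<gamma> powi j" using \<gamma>_ex by blast
    have "[int N * k + j = j] (mod int N)" by (simp add: cong_def)
    then show ?thesis using \<gamma>0 D'_iff[of "int N * k + j"] P_cong
      by (simp add: j D'_iff power_int_add)
  qed simp

  \<comment> \<open>Comparison of the two families of counts\<close>
  define F where "F l = triple_intersection (\<gamma> ^ l) a D' mod t" for l
  define G where "G l = triple_intersection (\<omega> ^ l) a Dinv mod t" for l
  have F_cong: "F l = F l'" if ll': "[l = l'] (mod N)" for l l'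
  proof -
    have "[int l = int l'] (mod int N)" using ll' by (simp add: cong_int_iff)
    \<comment> \<open>Here \<open>k\<close> is negative when \<open>l' < l\<close>, hence the
      integer exponent in \<open>scale_D'\<close>.\<close>
    then obtain k where "int l' = int l + int N * k" by (auto simp: cong_iff_lin)
    then have "\<gamma> ^ l' = \<gamma> powi (int N * k) * \<gamma> ^ l"
      using \<gamma>0 by (metis mult.commute power_int_add power_int_of_nat)
    then show ?thesis
      using \<gamma>0 scale_D' triple_intersection_scale[of "\<gamma> powi (int N * k)" D' "\<gamma> ^ l" a]
      by (simp add: F_def)
  qed
  have descend: "[triple_intersection x a D' = triple_intersection x a Dinv] (mod t)"
    if x: "x ^ q = x" for x
  proof -
    \<comment> \<open>The Frobenius power fixes \<open>x\<close> and \<open>a\<close>, so it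
      respects both shifts and acts on \<open>S\<close>; its \<open>t\<close>-th iterate is the
      identity because the field has \<open>q ^ t\<close> elements.\<close>
    define S where "S = {e \<in> D'. e + x \<in> D' \<and> e + a * x \<in> D'}"
    have shift: "(e + x) ^ q = e ^ q + x" "(e + a * x) ^ q = e ^ q + a * x" for e
      using x aq by (simp_all add: frob_add power_mult_distrib)
    have iter: "((\<lambda>y. y ^ q) ^^ n) y = y ^ (q ^ n)" for n and y :: 'a
      by (induction n) (simp_all add: mult.commute flip: power_mult)
    have "[card S = card {e \<in> S. e ^ q = e}] (mod t)"
    proof (rule card_cong_card_fixed_points[OF t(1)])
      show "(\<lambda>y. y ^ q) ` S \<subseteq> S"
        unfolding S_def using frob_D' shift by fastforce
      show "((\<lambda>y. y ^ q) ^^ t) y = y" for y :: 'a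
        using finite_field_power_card_eq_same[of y] by (simp add: iter card_field)
    qed simp
    \<comment> \<open>If \<open>e\<close> is fixed, so are \<open>e + x\<close> and
      \<open>e + a * x\<close>; for fixed elements \<open>D'\<close> and \<open>Dinv\<close>
      coincide.\<close>
    moreover have "{e \<in> S. e ^ q = e} = {e \<in> Dinv. e + x \<in> Dinv \<and> e + a * x \<in> Dinv}"
      unfolding S_def Dinv_fixed using shift by auto
    ultimately show ?thesis by (simp add: triple_intersection_eq S_def)
  qed
  have G_F: "G l = F (t * l)" for l
  proof -
    have "(\<omega> ^ l) ^ q = \<omega> ^ l"
      using \<omega>_fixed[of "\<omega> ^ l"] \<omega>0 by (metis power_int_of_nat power_not_zero)
    then have "G l = triple_intersection (\<omega> ^ l) a D' mod t"
      using descend by (simp add: G_def cong_def)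
    also have "\<dots> = F (r * l)" by (simp add: F_def \<omega> r_def power_mult)
    also have "\<dots> = F (t * l)"
      by (rule F_cong, rule cong_scalar_right) (use rt in \<open>simp add: cong_int_iff\<close>)
    finally show ?thesis .
  qed
  have "F ` {0..N - 1} = G ` {0..N - 1}"
    using N0 G_F F_cong tinv by (rule image_eq_of_mult_mod)
  then show ?thesis using u unfolding F_def G_def by (simp only: Setcompr_eq_image)
qed

end
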